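(* Let $G=(V,E)$ be a weakly connected directed acyclic graph with $n$ nodes, with fixed delays $m_{i,j}$ satisfying the single-delay convention (for every node $i$ and every excited node $j$ having a path to $i$, all directed paths from $j$ to $i$ have the same total delay). Let $(\mathcal{N}^e,\mathcal{N}^m)$ be an identification pattern with $N^{m,e}=|\mathcal{N}^e|+|\mathcal{N}^m|=n$, and let $\{f\}=\{f_{i,j}\}_{(i,j)\in E}$ be functions in $\mathcal{F}_{Z,NL}$ such that the associated nonlinear network matrix $J_G(\mathbf{v})$ is generic. Suppose that: 1) all the sources are excited, all the sinks are measured, and the other nodes are either excited or measured; 2) for each node $i\in V$, there are vertex-disjoint paths from excited nodes to the in-neighbors of $i$, i.e. there are $|\mathcal{N}_i|$ mutually vertex-disjoint directed paths, each starting at an excited node, such that each in-neighbor of $i$ is the endpoint of one of them. Then the network is identifiable in the class $\mathcal{F}_{Z,NL}$: for every family $\{\tilde f\}=\{\tilde f_{i,j}\}_{(i,j)\in E}$ of functions in $\mathcal{F}_{Z,NL}$, $F(\mathcal{N}^m)=\tilde F(\mathcal{N}^m)$ implies $f_{i,j}=\tilde f_{i,j}$ for all $(i,j)\in E$.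
   Context: Graph. $G=(V,E)$ is a weakly connected directed acyclic graph (DAG), $V=\{1,\dots,n\}$, $E\subseteq V\times V$. An element $(i,j)\in E$ denotes an edge from $j$ to $i$; $\mathcal{N}_i=\{j:(i,j)\in E\}$ is the set of in-neighbors of $i$. A source is a node with no in-neighbors; a sink is a node with no out-neighbors. A group of paths is mutually vertex disjoint if no two paths of the group contain the same vertex; paths of length zero (a single vertex, e.g. an in-neighbor which is itself excited) are allowed. Identification pattern. A pair $(\mathcal{N}^e,\mathcal{N}^m)$ with $\mathcal{N}^e\subseteq V$ (excited nodes) and $\mathcal{N}^m\subseteq V$ (measured nodes). The number of identification actions is $N^{m,e}=|\mathcal{N}^e|+|\mathcal{N}^m|$. Model. Each edge $(i,j)\in E$ carries a fixed known finite delay $m_{i,j}\in\{1,2,\dots\}$ and a function $f_{i,j}:\mathbb{R}\to\mathbb{R}$. The node outputs satisfy, at each time $k$, $$y_i^k=\sum_{j\in\mathcal{N}_i} f_{i,j}\big(y_j^{k-m_{i,j}}\big)+u_i^{k-1},\qquad i\in V,$$ where superscripts denote time instants, $u_i$ is an arbitrary real excitation signal if $i\in\mathcal{N}^e$, and $u_i\equiv 0$ if $i\notin\mathcal{N}^e$. The functions $F_i$. Since $G$ is acyclic, unrolling the model gives $y_i^k=u_i^{k-1}+F_i$, where $F_i$ is a function of finitely many delayed values of the excitation signals of excited nodes having a path to $i$. Explicitly, $F_i=\sum_{j\in\mathcal{N}_i} f_{i,j}\big(u_j^{k-m_{i,j}-1}+F_j^{(m_{i,j})}\big)$, where $F_j^{(s)}$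 is $F_j$ with all its inputs delayed by $s$, and $u_j=0$ for non-excited $j$. The set of measured functions is $F(\mathcal{N}^m)=\{F_i: i\in\mathcal{N}^m\}$. For another family $\{\tilde f\}$ on the same graph with the same delays and pattern, $\tilde F_i$ denotes the corresponding functions; $F(\mathcal{N}^m)=\tilde F(\mathcal{N}^m)$ means $F_i=\tilde F_i$ as functions (for all real values of the inputs) for each $i\in\mathcal{N}^m$. Single-delay convention. The total delay of a path is the sum of the delays $m$ of its edges. The convention that all directed paths from an excited node $j$ to $i$ have the same total delay means that in $F_i$ each excitation signal $u_j$ occurs with only one delay: $y_i^k=u_i^{k-1}+F_i(u_1^{k-T_{i,1}},\dots,u_{n_i}^{k-T_{i,n_i}})$, where $1,\dots,n_i$ are the excited nodes with a path to $i$ and $T_{i,j}$ is the common total delay plus $1$. Class $\mathcal{F}_{Z,NL}$. The set of $f:\mathbb{R}\to\mathbb{R}$ such that: (1) $f$ is real analytic on $\mathbb{R}$; (2) $f(0)=0$; (3) the Taylor series $f(x)=\sum_{n\ge1}a_nx^n$ at $0$ has some $a_n\ne0$ with $n>1$; (4) the range of $f$ is $\mathbb{R}$. Nonlinear network matrix. For $\mathbf{v}=(v_j)_{j\in\mathcal{N}^e}\in\mathbb{R}^{|\mathcal{N}^e|}$, let $y_j(\mathbf{v})$ be the output of node $j$ when all occurrences of the excitation signal of each excited node $l$, whatever their delay, are replaced by the same variable $v_l$; i.e. recursively $y_j(\mathbf{v})=v_j+\sum_{l\in\mathcal{N}_j}f_{j,l}(y_l(\mathbf{v}))$, with $v_j=0$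 if $j\notin\mathcal{N}^e$. The nonlinear network matrix $J_G(\mathbf{v})\in\mathbb{R}^{n\times n}$ has entries $[J_G(\mathbf{v})]_{i,j}=f'_{i,j}(y_j(\mathbf{v}))$ if $(i,j)\in E$ and $0$ otherwise. Put $T_G(\mathbf{v})=(I-J_G(\mathbf{v}))^{-1}$ (well defined since $G$ is acyclic). For $A,B\subseteq V$, $T_G^{A,B}(\mathbf{v})$ is the submatrix of $T_G(\mathbf{v})$ with rows indexed by $A$ and columns indexed by $B$. Its rank is called maximal if it equals the maximum of the rank of the $(A,B)$ submatrix of $(I-J)^{-1}$ over all real matrices $J$ with $[J]_{i,j}=0$ whenever $(i,j)\notin E$ (the entries for $(i,j)\in E$ being free variables). $J_G(\mathbf{v})$ is generic if there exists a point $\mathbf{v}^*\in\mathbb{R}^{|\mathcal{N}^e|}$ such that for all $A,B\subseteq V$ the submatrix $T_G^{A,B}(\mathbf{v}^* )$ has maximal rank. *)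

theory Defs
  imports "HOL-Analysis.Analysis"
begin

section \<open>Graphs\<close>

text \<open>
  The nodes are the elements of a finite type, so the number \<open>n\<close> of nodes is \<open>CARD('v)\<close>.
  A pair \<open>(i, j) \<in> E\<close> is an edge from \<open>j\<close> to \<open>i\<close> (head first).
\<close>

definition in_nbrs :: "('v \<times> 'v) set \<Rightarrow> 'v \<Rightarrow> 'v set" where
  "in_nbrs E i = {j. (i, j) \<in> E}"

definition out_nbrs :: "('v \<times> 'v) set \<Rightarrow> 'v \<Rightarrow> 'v set" where
  "out_nbrs E j = {i. (i, j) \<in> E}"

definition is_source :: "('v \<times> 'v) set \<Rightarrow> 'v \<Rightarrow> bool" where
  "is_source E i \<longleftrightarrow> in_nbrs E i = {}"

definition is_sink :: "('v \<times> 'v) set \<Rightarrow> 'v \<Rightarrow> bool" where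
  "is_sink E i \<longleftrightarrow> out_nbrs E i = {}"

definition weakly_connected :: "('v \<times> 'v) set \<Rightarrow> bool" where
  "weakly_connected E \<longleftrightarrow> (\<forall>i j. (i, j) \<in> (E \<union> E\<inverse>)\<^sup>*)"

text \<open>
  A path is the list of its vertices, in the order in which it visits them; \<open>[j]\<close> is the
  path of length zero at \<open>j\<close>.  In an acyclic graph the vertices of such a list are
  automatically distinct.
\<close>

definition is_path :: "('v \<times> 'v) set \<Rightarrow> 'v list \<Rightarrow> bool" where
  "is_path E p \<longleftrightarrow> p \<noteq> [] \<and> successively (\<lambda>a b. (b, a) \<in> E) p"

definition path_delay :: "('v \<Rightarrow> 'v \<Rightarrow> nat) \<Rightarrow> 'v list \<Rightarrow> nat" where
  "path_delay m p = (\<Sum>(a, b)\<leftarrow>zip p (tl p). m b a)"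

definition single_delay :: "('v \<times> 'v) set \<Rightarrow> ('v \<Rightarrow> 'v \<Rightarrow> nat) \<Rightarrow> 'v set \<Rightarrow> bool" where
  "single_delay E m Ne \<longleftrightarrow>
     (\<forall>i. \<forall>j\<in>Ne. \<forall>p q. is_path E p \<and> hd p = j \<and> last p = i \<and>
                       is_path E q \<and> hd q = j \<and> last q = i \<longrightarrow>
                       path_delay m p = path_delay m q)"

definition disjoint_paths_to :: "('v \<times> 'v) set \<Rightarrow> 'v set \<Rightarrow> 'v set \<Rightarrow> bool" where
  "disjoint_paths_to E Ne N \<longleftrightarrow>
     (\<exists>P. finite P \<and> card P = card N \<and>
          (\<forall>p\<in>P. is_path E p \<and> hd p \<in> Ne) \<and>
          (\<forall>p\<in>P. \<forall>q\<in>P. p \<noteq> q \<longrightarrow> set p \<inter> set q = {}) \<and>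
          (\<forall>j\<in>N. \<exists>p\<in>P. last p = j))"


section \<open>The class of functions\<close>

definition real_analytic :: "(real \<Rightarrow> real) \<Rightarrow> bool" where
  "real_analytic f \<longleftrightarrow> (\<forall>x. \<exists>S. (\<lambda>h. f (x + h)) has_fps_expansion S)"

definition F_ZNL :: "(real \<Rightarrow> real) set" where
  "F_ZNL = {f. real_analytic f \<and> f 0 = 0 \<and>
               (\<exists>S. f has_fps_expansion S \<and> (\<exists>n>1. fps_nth S n \<noteq> 0)) \<and>
               range f = UNIV}"


section \<open>The measured functions\<close>

text \<open>
  \<open>unrolled E m f Ne u i k\<close> is the value at time \<open>k\<close> of the function \<open>F\<^sub>i\<close>, for the excitation
  signals \<open>u\<close>; only the signals of the nodes in \<open>Ne\<close> are used.  Two functions \<open>F\<^sub>i\<close> agree for all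
  real values of their (finitely many, delayed) inputs iff \<open>unrolled\<close> agrees for all signals
  \<open>u\<close> and all times \<open>k\<close>.
\<close>

definition excitation :: "'v set \<Rightarrow> ('v \<Rightarrow> int \<Rightarrow> real) \<Rightarrow> 'v \<Rightarrow> int \<Rightarrow> real" where
  "excitation Ne u j t = (if j \<in> Ne then u j t else 0)"

function (domintros) unrolled ::
  "('v \<times> 'v) set \<Rightarrow> ('v \<Rightarrow> 'v \<Rightarrow> nat) \<Rightarrow> ('v \<Rightarrow> 'v \<Rightarrow> real \<Rightarrow> real) \<Rightarrow> 'v set \<Rightarrow>
   ('v \<Rightarrow> int \<Rightarrow> real) \<Rightarrow> 'v \<Rightarrow> int \<Rightarrow> real" where
  "unrolled E m f Ne u i k =
     (\<Sum>j\<in>in_nbrs E i. f i j (excitation Ne u j (k - int (m i j) - 1)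
                               + unrolled E m f Ne u j (k - int (m i j))))"
  by pat_completeness auto

text \<open>The recursion is well founded on every finite acyclic graph.\<close>

lemma unrolled_dom:
  fixes E :: "('v::finite \<times> 'v) set"
  assumes "acyclic E"
  shows "unrolled_dom (E, m, f, Ne, u, i, k)"
proof -
  have "wf (E\<inverse>)"
    using assms by (intro finite_acyclic_wf_converse) auto
  then show ?thesis
  proof (induction i arbitrary: k rule: wf_induct_rule)
    case (less i)
    show ?case
      by (rule unrolled.domintros) (use less in \<open>auto simp: in_nbrs_def\<close>)
  qed
qed

lemma unrolled_rec:
  fixes E :: "('v::finite \<times> 'v) set"
  assumes "acyclic E"
  shows "unrolled E m f Ne u i k =
     (\<Sum>j\<in>in_nbrs E i. f i j (excitation Ne u j (k - int (m i j) - 1)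
                               + unrolled E m f Ne u j (k - int (m i j))))"
  by (rule unrolled.psimps[OF unrolled_dom[OF assms]])

text \<open>\<open>F\<^sub>i\<close> is the function for which the outputs are \<open>y\<^sub>i\<^sup>k = u\<^sub>i\<^sup>k\<^sup>-\<^sup>1 + F\<^sub>i\<close>.\<close>

lemma model_iff_unrolled:
  fixes E :: "('v::finite \<times> 'v) set" and y :: "'v \<Rightarrow> int \<Rightarrow> real"
  assumes "acyclic E"
  shows "(\<forall>i k. y i k = (\<Sum>j\<in>in_nbrs E i. f i j (y j (k - int (m i j))))
                           + excitation Ne u i (k - 1)) \<longleftrightarrow>
         (\<forall>i k. y i k = excitation Ne u i (k - 1) + unrolled E m f Ne u i k)"
    (is "?model \<longleftrightarrow> ?sol")
proof
  assume M: ?model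
  have "wf (E\<inverse>)"
    using assms by (intro finite_acyclic_wf_converse) auto
  then have "y i k = excitation Ne u i (k - 1) + unrolled E m f Ne u i k" for i k
  proof (induction i arbitrary: k rule: wf_induct_rule)
    case (less i)
    have "y i k = (\<Sum>j\<in>in_nbrs E i. f i j (y j (k - int (m i j)))) + excitation Ne u i (k - 1)"
      using M by blast
    also have "(\<Sum>j\<in>in_nbrs E i. f i j (y j (k - int (m i j)))) = unrolled E m f Ne u i k"
      unfolding unrolled_rec[OF assms, of m f Ne u i k]
      by (intro sum.cong refl) (use less in \<open>auto simp: in_nbrs_def\<close>)
    finally show ?case by simp
  qed
  then show ?sol by blast
next
  assume S: ?sol
  show ?model
  proof (intro allI)
    fix i k
    have "(\<Sum>j\<in>in_nbrs E i. f i j (y j (k - int (m i j)))) = unrolled E m f Ne u i k"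
      unfolding unrolled_rec[OF assms, of m f Ne u i k]
      by (intro sum.cong refl) (use S in \<open>simp add: algebra_simps\<close>)
    then show "y i k = (\<Sum>j\<in>in_nbrs E i. f i j (y j (k - int (m i j))))
                         + excitation Ne u i (k - 1)"
      using S by simp
  qed
qed


section \<open>The nonlinear network matrix\<close>

text \<open>
  A point of \<open>\<real>\<close> to the power \<open>|Ne|\<close> is given by a function \<open>v\<close> on all nodes, of which only
  the values on \<open>Ne\<close> are used.
\<close>

function (domintros) static_output ::
  "('v \<times> 'v) set \<Rightarrow> ('v \<Rightarrow> 'v \<Rightarrow> real \<Rightarrow> real) \<Rightarrow> 'v set \<Rightarrow> ('v \<Rightarrow> real) \<Rightarrow> 'v \<Rightarrow> real" where
  "static_output E f Ne v j =
     (if j \<in> Ne then v j else 0) + (\<Sum>l\<in>in_nbrs E j. f j l (static_output E f Ne v l))"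
  by pat_completeness auto

lemma static_output_dom:
  fixes E :: "('v::finite \<times> 'v) set"
  assumes "acyclic E"
  shows "static_output_dom (E, f, Ne, v, j)"
proof -
  have "wf (E\<inverse>)"
    using assms by (intro finite_acyclic_wf_converse) auto
  then show ?thesis
  proof (induction j rule: wf_induct_rule)
    case (less j)
    show ?case
      by (rule static_output.domintros) (use less in \<open>auto simp: in_nbrs_def\<close>)
  qed
qed

lemma static_output_rec:
  fixes E :: "('v::finite \<times> 'v) set"
  assumes "acyclic E"
  shows "static_output E f Ne v j =
     (if j \<in> Ne then v j else 0) + (\<Sum>l\<in>in_nbrs E j. f j l (static_output E f Ne v l))"
  by (rule static_output.psimps[OF static_output_dom[OF assms]])

definition network_matrix ::
  "('v::finite \<times> 'v) set \<Rightarrow> ('v \<Rightarrow> 'v \<Rightarrow> real \<Rightarrow> real) \<Rightarrow> 'v set \<Rightarrow> ('v \<Rightarrow> real) \<Rightarrow> real^'v^'v"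
  where
  "network_matrix E f Ne v =
     (\<chi> i j. if (i, j) \<in> E then deriv (f i j) (static_output E f Ne v j) else 0)"

definition transfer_matrix :: "real^'v^'v \<Rightarrow> real^'v::finite^'v" where
  "transfer_matrix J = matrix_inv (mat 1 - J)"

text \<open>
  The rank of the submatrix with rows in \<open>A\<close> and columns in \<open>B\<close>: instead of being deleted, the
  other rows and columns are replaced by zero, which does not affect the rank.
\<close>

definition sub_rank :: "'v set \<Rightarrow> 'w set \<Rightarrow> real^'w^'v \<Rightarrow> nat" where
  "sub_rank A B M = rank ((\<chi> i j. if i \<in> A \<and> j \<in> B then M $ i $ j else 0) :: real^'w^'v)"

lemma sub_rank_eq_rank_submatrix:
  fixes M :: "real^'w^'v" and a :: "'r::finite \<Rightarrow> 'v" and b :: "'c::finite \<Rightarrow> 'w"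
  assumes a: "inj a" "range a = A" and b: "inj b" "range b = B"
  shows "sub_rank A B M = rank ((\<chi> i j. M $ a i $ b j) :: real^'c^'r)"
proof -
  define Z :: "real^'w^'v" where "Z = (\<chi> i j. if i \<in> A \<and> j \<in> B then M $ i $ j else 0)"
  define S :: "real^'c^'r" where "S = (\<chi> i j. M $ a i $ b j)"
  define P :: "real^'v^'r" where "P = (\<chi> i k. if k = a i then 1 else 0)"
  define Q :: "real^'c^'w" where "Q = (\<chi> l j. if l = b j then 1 else 0)"
  have "(\<Sum>l\<in>UNIV. (\<Sum>k\<in>UNIV. (if k = a i then 1 else 0) * Z $ k $ l) * (if l = b j then 1 else 0))
          = M $ a i $ b j" for i j
  proof -
    have "(\<Sum>k\<in>UNIV. (if k = a i then 1 else 0) * Z $ k $ l) = Z $ a i $ l" for l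
      by (simp add: if_distrib[of "\<lambda>x. x * _"] cong: if_cong)
    then have "(\<Sum>l\<in>UNIV. (\<Sum>k\<in>UNIV. (if k = a i then 1 else 0) * Z $ k $ l) * (if l = b j then 1 else 0))
          = Z $ a i $ b j"
      by (simp add: if_distrib[of "\<lambda>x. _ * x"] cong: if_cong)
    also have "\<dots> = M $ a i $ b j"
      using a b by (auto simp: Z_def)
    finally show ?thesis .
  qed
  then have S_eq: "S = P ** Z ** Q"
    by (simp add: S_def P_def Q_def vec_eq_iff matrix_matrix_mult_def)
  have row: "(\<Sum>k\<in>UNIV. (if i = a k then 1 else 0) * g k) =
             (if i \<in> A then g (inv a i) else (0::real))" for i g
  proof (cases "i \<in> A")
    case True
    then obtain r where r: "i = a r" using a by auto
    have "(\<Sum>k\<in>UNIV. (if i = a k then 1 else 0) * g k) = (\<Sum>k\<in>UNIV. if k = r then g k else 0)"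
      using a r by (intro sum.cong) (auto dest: injD)
    then show ?thesis using True r a by simp
  qed (use a in \<open>auto intro!: sum.neutral\<close>)
  have col: "(\<Sum>k\<in>UNIV. g k * (if j = b k then 1 else 0)) =
             (if j \<in> B then g (inv b j) else (0::real))" for j g
  proof (cases "j \<in> B")
    case True
    then obtain r where r: "j = b r" using b by auto
    have "(\<Sum>k\<in>UNIV. g k * (if j = b k then 1 else 0)) = (\<Sum>k\<in>UNIV. if k = r then g k else 0)"
      using b r by (intro sum.cong) (auto dest: injD)
    then show ?thesis using True r b by simp
  qed (use b in \<open>auto intro!: sum.neutral\<close>)
  have "inv a (a i) = i" "inv b (b j) = j" for i j
    using a b by simp_all
  then have Z_eq: "Z = transpose P ** S ** transpose Q"
    using a b by (auto simp: vec_eq_iff matrix_matrix_mult_def transpose_def P_def Q_def S_def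
        Z_def row col)
  have "rank S \<le> rank Z"
    unfolding S_eq by (rule order_trans[OF rank_mul_le_left rank_mul_le_right])
  moreover have "rank Z \<le> rank S"
    unfolding Z_eq by (rule order_trans[OF rank_mul_le_left rank_mul_le_right])
  ultimately show ?thesis
    by (simp add: sub_rank_def Z_def S_def)
qed

definition max_sub_rank :: "('v::finite \<times> 'v) set \<Rightarrow> 'v set \<Rightarrow> 'v set \<Rightarrow> nat" where
  "max_sub_rank E A B =
     Max {sub_rank A B (transfer_matrix J) | J :: real^'v^'v. \<forall>i j. (i, j) \<notin> E \<longrightarrow> J $ i $ j = 0}"

definition generic_network ::
  "('v::finite \<times> 'v) set \<Rightarrow> ('v \<Rightarrow> 'v \<Rightarrow> real \<Rightarrow> real) \<Rightarrow> 'v set \<Rightarrow> bool" where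
  "generic_network E f Ne \<longleftrightarrow>
     (\<exists>v. \<forall>A B. sub_rank A B (transfer_matrix (network_matrix E f Ne v)) = max_sub_rank E A B)"

text \<open>\<open>I - J\<close> is invertible and the maximum ranges over a finite nonempty set.\<close>

lemma invertible_one_minus:
  fixes J :: "real^'v::finite^'v"
  assumes "acyclic E" and J: "\<And>i j. (i, j) \<notin> E \<Longrightarrow> J $ i $ j = 0"
  shows "invertible (mat 1 - J)"
proof -
  have wf: "wf (E\<inverse>)"
    using assms by (intro finite_acyclic_wf_converse) auto
  have "x = 0" if x: "(mat 1 - J) *v x = 0" for x
  proof -
    have Jx: "x $ i = (\<Sum>j\<in>UNIV. J $ i $ j * x $ j)" for i
    proof -
      have "x = J *v x" using x by (simp add: matrix_vector_mult_diff_rdistrib)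
      then have "x $ i = (J *v x) $ i" by simp
      then show ?thesis by (simp add: matrix_vector_mult_def)
    qed
    have "x $ i = 0" for i
      using wf
    proof (induction i rule: wf_induct_rule)
      case (less i)
      have "J $ i $ j * x $ j = 0" for j
        using less[of j] J[of i j] by (cases "(i, j) \<in> E") auto
      then show ?case by (subst Jx) (simp only: sum.neutral_const)
    qed
    then show ?thesis by (simp add: vec_eq_iff)
  qed
  then show ?thesis
    by (simp add: invertible_left_inverse matrix_left_invertible_ker)
qed

lemma max_sub_rank_finite_nonempty:
  fixes E :: "('v::finite \<times> 'v) set"
  defines "R \<equiv> \<lambda>A B. {sub_rank A B (transfer_matrix J) | J :: real^'v^'v.
                        \<forall>i j. (i, j) \<notin> E \<longrightarrow> J $ i $ j = 0}"
  shows "finite (R A B)" and "R A B \<noteq> {}"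
proof -
  have "sub_rank A B M \<le> CARD('v)" for M :: "real^'v^'v"
    unfolding sub_rank_def by (rule order_trans[OF rank_bound]) simp
  then have "R A B \<subseteq> {..CARD('v)}" by (auto simp: R_def)
  then show "finite (R A B)" by (rule finite_subset) simp
  have "sub_rank A B (transfer_matrix (0 :: real^'v^'v)) \<in> R A B"
    unfolding R_def by (rule CollectI, rule exI[of _ 0]) simp
  then show "R A B \<noteq> {}" by blast
qed

end

theory Submission
  imports Defs
begin

text \<open>
  Constant excitation signals reduce the claim to the static outputs \<open>y\<^sub>i(v)\<close>, which for the
  measured nodes do not depend on which of the two families is used.  Walking backwards from the
  sinks, the same follows for every excited node \<open>j\<close>: choose an out-neighbor \<open>i\<close> of \<open>j\<close> that no
  other out-neighbor of \<open>j\<close> has a path to.  Then \<open>v\<^sub>j\<close> enters \<open>y\<^sub>i\<close> only through the edge from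
  \<open>j\<close>, that is, through \<open>f\<^sub>i\<^sub>j(v\<^sub>j + F\<^sub>j)\<close>, and a nonlinear analytic \<open>f\<^sub>i\<^sub>j\<close> determines the shift
  \<open>F\<^sub>j\<close> of its argument.  Once all outputs agree, the disjoint paths and genericity make the
  outputs of the in-neighbors of \<open>i\<close> cover a nonempty open set, on which the sums of the
  \<open>f\<^sub>i\<^sub>j\<close> and of the \<open>g\<^sub>i\<^sub>j\<close> agree.  Hence \<open>f\<^sub>i\<^sub>j - g\<^sub>i\<^sub>j\<close> is constant on an interval, and so zero.
\<close>

section \<open>Zeros and derivatives of real analytic functions\<close>

text \<open>Dividing \<open>f\<close> by the power of \<open>x\<close> given by the subdegree leaves
  a function that is continuous at 0 and takes the leading coefficient, which is nonzero, as its
  value there.\<close>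

lemma has_fps_expansion_eventually_nonzero:
  fixes S :: "'a::{real_normed_field,banach} fps"
  assumes "f has_fps_expansion S" "S \<noteq> 0"
  shows "\<forall>\<^sub>F x in at 0. f x \<noteq> 0"
proof -
  define n where "n = subdegree S"
  define q where "q = (\<lambda>x. if x = 0 then fps_nth S n else f x / x ^ n)"
  have "q has_fps_expansion fps_shift n S"
    unfolding q_def by (rule has_fps_expansion_shift) (use assms in \<open>auto simp: n_def\<close>)
  then have "(q \<longlongrightarrow> q 0) (at 0)"
    using has_fps_expansion_imp_continuous[where A = UNIV] by (simp add: continuous_within)
  moreover have "q 0 \<noteq> 0"
    using assms(2) by (simp add: q_def n_def)
  ultimately have "\<forall>\<^sub>F x in at 0. q x \<noteq> 0"
    by (rule tendsto_imp_eventually_ne)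
  then show ?thesis
    using eventually_neq_at_within[of 0] by eventually_elim (auto simp: q_def)
qed

lemma real_analytic_diff:
  assumes "real_analytic f" "real_analytic g"
  shows "real_analytic (\<lambda>x. f x - g x)"
  using assms unfolding real_analytic_def by (fast intro: has_fps_expansion_diff)

lemma real_analytic_const: "real_analytic (\<lambda>x. c)"
  unfolding real_analytic_def by (fast intro: has_fps_expansion_const)

lemma real_analytic_imp_DERIV:
  assumes "real_analytic f"
  shows "(f has_field_derivative deriv f x) (at x)"
proof -
  obtain S where S: "(\<lambda>h. f (x + h)) has_fps_expansion S"
    using assms unfolding real_analytic_def by blast
  then have ev: "\<forall>\<^sub>F h in nhds 0. eval_fps S h = f (x + h)" and r: "fps_conv_radius S > 0"
    by (auto simp: has_fps_expansion_def)
  have "(eval_fps S has_field_derivative eval_fps (fps_deriv S) 0) (at 0)"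
    by (rule has_field_derivative_eval_fps) (use r in \<open>simp add: zero_ereal_def\<close>)
  then have "((\<lambda>h. f (x + h)) has_field_derivative eval_fps (fps_deriv S) 0) (at 0)"
    using DERIV_cong_ev[OF refl ev refl] by simp
  then have "(f has_field_derivative eval_fps (fps_deriv S) 0) (at x)"
    using DERIV_shift[of f _ 0 x] by (simp add: add.commute)
  then show ?thesis
    using DERIV_imp_deriv by metis
qed

text \<open>The points near which \<open>f\<close> vanishes form a set that is open by definition.
  Its complement is open too: outside it the local series is nonzero, so zeros are isolated.
  Connectedness of the line finishes the argument.\<close>

lemma real_analytic_identity:
  assumes "real_analytic f" "\<forall>\<^sub>F x in nhds a. f x = 0"
  shows "f x = 0"
proof -
  define Z where "Z = {x. \<forall>\<^sub>F y in nhds x. f y = 0}"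
  have "open Z"
  proof (subst open_subopen, intro ballI)
    fix x assume "x \<in> Z"
    then obtain U where "open U" "x \<in> U" "\<forall>y\<in>U. f y = 0"
      by (auto simp: Z_def eventually_nhds)
    then show "\<exists>T. open T \<and> x \<in> T \<and> T \<subseteq> Z"
      by (intro exI[of _ U]) (auto simp: Z_def eventually_nhds)
  qed
  moreover have "open (- Z)"
  proof (subst open_subopen, safe)
    fix x assume x: "x \<notin> Z"
    obtain S where S: "(\<lambda>h. f (x + h)) has_fps_expansion S"
      using assms(1) unfolding real_analytic_def by blast
    have "S \<noteq> 0"
    proof
      assume "S = 0"
      then have "\<forall>\<^sub>F h in nhds 0. 0 = f (x + h)"
        using S by (simp add: has_fps_expansion_def)
      then have "\<forall>\<^sub>F h in nhds 0. f (x + h) = 0"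
        by (rule eventually_mono) simp
      then have "\<forall>\<^sub>F y in nhds x. f y = 0"
        by (simp add: eventually_filtermap add.commute flip: filtermap_nhds_shift[of "- x" 0, simplified])
      then show False using x by (simp add: Z_def)
    qed
    then have "\<forall>\<^sub>F h in at 0. f (x + h) \<noteq> 0"
      using has_fps_expansion_eventually_nonzero[OF S] by simp
    then have "\<forall>\<^sub>F y in at x. f y \<noteq> 0"
      by (simp add: at_to_0[of x] eventually_filtermap add.commute)
    then obtain U where U: "open U" "x \<in> U" "\<And>y. y \<in> U \<Longrightarrow> y \<noteq> x \<Longrightarrow> f y \<noteq> 0"
      unfolding eventually_at_topological by blast
    have "y \<notin> Z" if "y \<in> U" for y
      using that U(3) x eventually_nhds_x_imp_x[of "\<lambda>y. f y = 0" y] by (cases "y = x") (auto simp: Z_def)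
    then show "\<exists>T. open T \<and> x \<in> T \<and> T \<subseteq> - Z"
      using U by blast
  qed
  ultimately have "Z = UNIV"
    using assms(2) connected_UNIV[where 'a = real] connected_clopen[of "UNIV :: real set"]
    by (auto simp: Z_def closed_def)
  then show ?thesis
    using eventually_nhds_x_imp_x[of "\<lambda>y. f y = 0" x] by (auto simp: Z_def)
qed

section \<open>Additivity and the class \<open>F_ZNL\<close>\<close>

text \<open>Differentiating the identity in \<open>x\<close> at 0 shows that the derivative of
  \<open>f\<close> is constant on the segment from 0 to \<open>d\<close>. Since zeros of a nonzero
  series are isolated, the series of the derivative is itself constant.\<close>

lemma additive_on_interval_imp_fps_linear:
  assumes f: "real_analytic f" and S: "f has_fps_expansion S" and "d \<noteq> 0" and "n > 1"
    and add: "\<And>t x. t \<in> {0..1} \<Longrightarrow> f (x + t * d) = f x + f (t * d)"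
  shows "fps_nth S n = 0"
proof -
  have deriv: "deriv f (t * d) = deriv f 0" if t: "t \<in> {0..1}" for t
  proof -
    have "((\<lambda>x. f (x + t * d)) has_field_derivative deriv f (t * d)) (at 0)"
      using real_analytic_imp_DERIV[OF f, of "t * d"] DERIV_shift[of f _ 0 "t * d"] by simp
    moreover have "((\<lambda>x. f x + f (t * d)) has_field_derivative deriv f 0) (at 0)"
      using real_analytic_imp_DERIV[OF f, of 0] by (auto intro!: derivative_eq_intros)
    ultimately show ?thesis
      using add[OF t] DERIV_unique by (simp add: DERIV_unique)
  qed
  have "fps_deriv S - fps_const (deriv f 0) = 0"
  proof (rule ccontr)
    assume "fps_deriv S - fps_const (deriv f 0) \<noteq> 0"
    moreover have "(\<lambda>x. deriv f x - deriv f 0) has_fps_expansion fps_deriv S - fps_const (deriv f 0)"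
      by (intro has_fps_expansion_diff has_fps_expansion_deriv has_fps_expansion_const S)
    ultimately have "\<forall>\<^sub>F x in at 0. deriv f x - deriv f 0 \<noteq> 0"
      by (rule has_fps_expansion_eventually_nonzero[rotated])
    then obtain e where e: "e > 0" "\<And>x. x \<noteq> 0 \<Longrightarrow> \<bar>x\<bar> < e \<Longrightarrow> deriv f x \<noteq> deriv f 0"
      by (auto simp: eventually_at dist_real_def)
    \<comment> \<open>This keeps \<open>t * d\<close> nonzero and on the segment, with absolute
      value at most \<open>e / 2\<close>.\<close>
    define t where "t = min 1 (e / (2 * \<bar>d\<bar>))"
    have t: "0 < t" "t \<le> 1" "t \<le> e / (2 * \<bar>d\<bar>)"
      using e(1) \<open>d \<noteq> 0\<close> by (auto simp: t_def)
    then have "\<bar>t * d\<bar> < e"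
      using e(1) \<open>d \<noteq> 0\<close> by (simp add: abs_mult field_simps)
    then show False
      using e(2)[of "t * d"] deriv[of t] t \<open>d \<noteq> 0\<close> by simp
  qed
  then have "fps_nth (fps_deriv S) (n - 1) = fps_nth (fps_const (deriv f 0)) (n - 1)"
    by simp
  then show ?thesis
    using \<open>n > 1\<close> by simp
qed

lemma F_ZNL_real_analytic: "f \<in> F_ZNL \<Longrightarrow> real_analytic f"
  and F_ZNL_0: "f \<in> F_ZNL \<Longrightarrow> f 0 = 0"
  by (auto simp: F_ZNL_def)

text \<open>A nonzero Taylor coefficient of degree above 1 excludes additivity along any
  nondegenerate segment.\<close>

lemma F_ZNL_not_additive_on_interval:
  assumes "f \<in> F_ZNL" "\<And>t x. t \<in> {0..1} \<Longrightarrow> f (x + t * d) = f x + f (t * d)"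
  shows "d = 0"
proof (rule ccontr)
  assume "d \<noteq> 0"
  obtain S n where "f has_fps_expansion S" "n > 1" "fps_nth S n \<noteq> 0"
    using assms(1) by (auto simp: F_ZNL_def)
  then show False
    using additive_on_interval_imp_fps_linear[OF F_ZNL_real_analytic[OF assms(1)] _ \<open>d \<noteq> 0\<close>] assms(2)
    by blast
qed

lemma F_ZNL_continuous:
  assumes "f \<in> F_ZNL" shows "continuous_on A f"
  by (rule DERIV_continuous_on[where D = "deriv f"],
      rule has_field_derivative_at_within,
      rule real_analytic_imp_DERIV[OF F_ZNL_real_analytic[OF assms]])

section \<open>Static outputs and their derivatives\<close>

text \<open>Constant signals make the delays invisible, so both recursions coincide. The own
  excitation of \<open>i\<close> is added because it is no part of the unrolled function.\<close>

lemma unrolled_const: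
  fixes E :: "('v::finite \<times> 'v) set"
  assumes "acyclic E"
  shows "(if i \<in> Ne then v i else 0) + unrolled E m f Ne (\<lambda>j t. v j) i k = static_output E f Ne v i"
proof -
  have "wf (E\<inverse>)"
    using assms by (intro finite_acyclic_wf_converse) auto
  then show ?thesis
  proof (induction i arbitrary: k rule: wf_induct_rule)
    case (less i)
    then show ?case
      unfolding unrolled_rec[OF assms, of m f Ne _ i] static_output_rec[OF assms, of f Ne v i]
      by (auto intro!: sum.cong simp: excitation_def in_nbrs_def)
  qed
qed

lemma invertible_matrix_inv:
  assumes "invertible A"
  shows "A ** matrix_inv A = mat 1" "matrix_inv A ** A = mat 1"
  using assms someI_ex[of "\<lambda>B. A ** B = mat 1 \<and> B ** A = mat 1"]
  unfolding invertible_def matrix_inv_def by blast+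

context
  fixes E :: "('v::finite \<times> 'v) set"
  assumes dag: "acyclic E"
begin

lemma wf_edges: "wf E" "wf (E\<inverse>)"
  using dag by (auto intro: finite_acyclic_wf finite_acyclic_wf_converse)

text \<open>Edges are stored head first, so \<open>(i, k) \<in> E\<^sup>*\<close> means that a path
  leads from \<open>k\<close> to \<open>i\<close>; an excitation acts only downstream.\<close>

lemma static_output_cong:
  assumes "\<And>k. (i, k) \<in> E\<^sup>* \<Longrightarrow> k \<in> Ne \<Longrightarrow> v k = w k"
  shows "static_output E f Ne v i = static_output E f Ne w i"
  using wf_edges(2) assms
proof (induction i rule: wf_induct_rule)
  case (less i)
  have "static_output E f Ne v j = static_output E f Ne w j" if "j \<in> in_nbrs E i" for j
    by (rule less) (use that less.prems in \<open>auto simp: in_nbrs_def intro: converse_rtrancl_into_rtrancl\<close>)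
  moreover have "i \<in> Ne \<Longrightarrow> v i = w i"
    using less.prems by blast
  ultimately show ?case
    by (simp add: static_output_rec[OF dag, of f Ne _ i] cong: sum.cong)
qed

lemma static_output_0:
  assumes "\<forall>(i, j)\<in>E. f i j 0 = 0"
  shows "static_output E f Ne (\<lambda>k. 0) i = 0"
  using wf_edges(2)
proof (induction i rule: wf_induct_rule)
  case (less i)
  then show ?case
    using assms by (auto simp: static_output_rec[OF dag, of f Ne _ i] in_nbrs_def intro!: sum.neutral)
qed

lemma continuous_on_static_output:
  assumes f: "\<forall>(i, j)\<in>E. continuous_on UNIV (f i j)"
    and v: "\<And>k. continuous_on A (\<lambda>t. v t k)"
  shows "continuous_on A (\<lambda>t. static_output E f Ne (v t) i)"
  using wf_edges(2)
proof (induction i rule: wf_induct_rule)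
  case (less i)
  have "continuous_on A (\<lambda>t. f i j (static_output E f Ne (v t) j))" if "j \<in> in_nbrs E i" for j
    by (rule continuous_on_compose2[of UNIV "f i j"]) (use that f less in \<open>auto simp: in_nbrs_def\<close>)
  then show ?case
    unfolding static_output_rec[OF dag, of f Ne _ i]
    using v by (cases "i \<in> Ne") (auto intro!: continuous_intros)
qed

text \<open>Since \<open>I - J\<close> is invertible, the node equations \<open>y = x + J y\<close>
  have a unique solution; a guessed \<open>y\<close> only has to be checked against them.\<close>

lemma transfer_matrix_mult_eqI:
  fixes J :: "real^'v^'v"
  assumes J: "\<And>i j. (i, j) \<notin> E \<Longrightarrow> J $ i $ j = 0"
    and "\<And>i. y $ i = x $ i + (\<Sum>j\<in>UNIV. J $ i $ j * y $ j)"
  shows "transfer_matrix J *v x = y"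
proof -
  have "((mat 1 - J) *v y) $ i = x $ i" for i
    using assms(2)[of i] by (simp add: matrix_vector_mult_diff_rdistrib matrix_vector_mult_def[of J])
  then have "x = (mat 1 - J) *v y"
    by (simp add: vec_eq_iff)
  moreover have "matrix_inv (mat 1 - J) ** (mat 1 - J) = mat 1"
    by (rule invertible_matrix_inv(2)[OF invertible_one_minus[OF dag J]])
  ultimately show ?thesis
    by (simp add: transfer_matrix_def matrix_vector_mul_assoc)
qed

lemma transfer_matrix_mult_rec:
  fixes J :: "real^'v^'v"
  assumes J: "\<And>i j. (i, j) \<notin> E \<Longrightarrow> J $ i $ j = 0"
  shows "(transfer_matrix J *v x) $ i =
    x $ i + (\<Sum>j\<in>in_nbrs E i. J $ i $ j * (transfer_matrix J *v x) $ j)"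
proof -
  have "(mat 1 - J) ** matrix_inv (mat 1 - J) = mat 1"
    by (rule invertible_matrix_inv(1)[OF invertible_one_minus[OF dag J]])
  then have "(mat 1 - J) *v (transfer_matrix J *v x) = x"
    by (simp add: transfer_matrix_def matrix_vector_mul_assoc)
  then have "(transfer_matrix J *v x) $ i = x $ i + (J *v (transfer_matrix J *v x)) $ i"
    by (simp add: matrix_vector_mult_diff_rdistrib vec_eq_iff algebra_simps)
  also have "(J *v (transfer_matrix J *v x)) $ i = (\<Sum>j\<in>in_nbrs E i. J $ i $ j * (transfer_matrix J *v x) $ j)"
    unfolding matrix_vector_mult_def[of J] vec_lambda_beta
    by (intro sum.mono_neutral_right) (auto simp: in_nbrs_def, metis J)
  finally show ?thesis .
qed

text \<open>Differentiating the node equations gives a linear recursion with weights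
  \<open>J\<close>, which the transfer matrix also satisfies. Rank conditions on the transfer matrix
  thus become conditions on the derivative of the outputs.\<close>

lemma static_output_has_derivative:
  fixes f :: "'v \<Rightarrow> 'v \<Rightarrow> real \<Rightarrow> real" and v :: "real^'v" and Ne :: "'v set"
  assumes f: "\<And>i j x. (i, j) \<in> E \<Longrightarrow> (f i j has_field_derivative deriv (f i j) x) (at x)"
  defines "J \<equiv> network_matrix E f Ne (($) v)"
  shows "((\<lambda>x. static_output E f Ne (($) x) i) has_derivative
    (\<lambda>h. (transfer_matrix J *v (\<chi> k. if k \<in> Ne then h $ k else 0)) $ i)) (at v)"
  using wf_edges(2)
proof (induction i rule: wf_induct_rule)
  case (less i)
  define D where "D = (\<lambda>h :: real^'v. transfer_matrix J *v (\<chi> k. if k \<in> Ne then h $ k else 0))"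
  have D: "D h $ i = (if i \<in> Ne then h $ i else 0) + (\<Sum>j\<in>in_nbrs E i. J $ i $ j * D h $ j)" for h
    unfolding D_def by (subst transfer_matrix_mult_rec) (simp_all add: J_def network_matrix_def)
  have "((\<lambda>x. f i j (static_output E f Ne (($) x) j)) has_derivative (\<lambda>h. J $ i $ j * D h $ j)) (at v)"
    if "j \<in> in_nbrs E i" for j
  proof -
    have ij: "(i, j) \<in> E" using that by (simp add: in_nbrs_def)
    have fij: "(f i j has_derivative (*) (J $ i $ j)) (at (static_output E f Ne (($) v) j))"
      using f[OF ij] ij by (simp add: has_field_derivative_def J_def network_matrix_def)
    have "((\<lambda>x. static_output E f Ne (($) x) j) has_derivative (\<lambda>h. D h $ j)) (at v)"
      using less ij by (simp add: D_def)
    then show ?thesis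
      by (rule has_derivative_compose[where f = "\<lambda>x. static_output E f Ne (($) x) j" and g = "f i j", OF _ fij])
  qed
  then have "((\<lambda>x. (if i \<in> Ne then x $ i else 0) + (\<Sum>j\<in>in_nbrs E i. f i j (static_output E f Ne (($) x) j)))
    has_derivative (\<lambda>h. D h $ i)) (at v)"
    unfolding D
    by (intro has_derivative_add has_derivative_sum bounded_linear_imp_has_derivative)
       (cases "i \<in> Ne", auto intro: bounded_linear_vec_nth)
  then show ?case
    by (simp add: D_def static_output_rec[OF dag, of f Ne _ i, symmetric])
qed


section \<open>Disjoint paths and the maximal rank\<close>

text \<open>The transitive closure relates every earlier position to every later one, so a repeated
  vertex would lie on a cycle.\<close>

lemma is_path_distinct:
  assumes "is_path E p"
  shows "distinct p"
proof -
  have "successively (\<lambda>a b. (b, a) \<in> E\<^sup>+) p"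
    using assms unfolding is_path_def by (auto elim: successively_mono)
  then have "sorted_wrt (\<lambda>a b. (b, a) \<in> E\<^sup>+) p"
    by (subst (asm) successively_conv_sorted_wrt) (auto simp: transp_def)
  then have *: "(p ! l, p ! k) \<in> E\<^sup>+" if "k < l" "l < length p" for k l
    using that by (simp add: sorted_wrt_iff_nth_less)
  show ?thesis
    unfolding distinct_conv_nth
  proof (intro allI impI)
    fix k l assume "k < length p" "l < length p" "k \<noteq> l"
    then show "p ! k \<noteq> p ! l"
      using *[of k l] *[of l k] dag by (cases "k < l") (auto simp: acyclic_def)
  qed
qed

text \<open>
  The weights are put on the edges of the disjoint paths only, so that each path transfers the
  excitation of its first node, undiminished, to exactly the nodes of that path.
\<close>

lemma card_le_max_sub_rank:
  assumes "disjoint_paths_to E Ne N"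
  shows "card N \<le> max_sub_rank E N Ne"
proof -
  obtain P where P: "\<forall>p\<in>P. is_path E p \<and> hd p \<in> Ne"
    and disj: "\<forall>p\<in>P. \<forall>q\<in>P. p \<noteq> q \<longrightarrow> set p \<inter> set q = {}"
    and "\<forall>j\<in>N. \<exists>p\<in>P. last p = j"
    using assms unfolding disjoint_paths_to_def by auto
  then obtain r where r: "\<And>j. j \<in> N \<Longrightarrow> r j \<in> P" "\<And>j. j \<in> N \<Longrightarrow> last (r j) = j"
    by metis
  have path: "is_path E p" and hd: "hd p \<in> Ne" if "p \<in> P" for p
    using that P by auto
  define step where "step a b \<longleftrightarrow> (\<exists>p\<in>P. \<exists>k. Suc k < length p \<and> p ! k = b \<and> p ! Suc k = a)" for a b
  define J :: "real^'v^'v" where "J = (\<chi> a b. if step a b then 1 else 0)"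
  have "(a, b) \<in> E" if ab: "step a b" for a b
  proof -
    obtain p k where "p \<in> P" "Suc k < length p" "p ! k = b" "p ! Suc k = a"
      using ab unfolding step_def by blast
    then show ?thesis
      using path[of p] by (auto simp: is_path_def successively_conv_nth)
  qed
  then have J: "J $ a $ b = 0" if "(a, b) \<notin> E" for a b
    using that by (auto simp: J_def)
  have same: "p = q" if "p \<in> P" "q \<in> P" "a \<in> set p" "a \<in> set q" for p q a
    using disj that by blast
  have T: "transfer_matrix J *v axis (hd p) 1 = (\<chi> a. if a \<in> set p then 1 else 0)" (is "_ = ?w")
    if p: "p \<in> P" for p
  proof (rule transfer_matrix_mult_eqI[OF J])
    fix a
    have dist: "distinct p" and ne: "p \<noteq> []"
      using is_path_distinct path[OF p] by (auto simp: is_path_def)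
    \<comment> \<open>By disjointness, a step that touches \<open>p\<close> is a step of
      \<open>p\<close> itself.\<close>
    have step: "step a b \<longleftrightarrow> (\<exists>k. Suc k < length p \<and> p ! k = b \<and> p ! Suc k = a)"
      if "a \<in> set p \<or> b \<in> set p" for b
      unfolding step_def
    proof safe
      fix q k assume q: "q \<in> P" "Suc k < length q" "a = q ! Suc k" "b = q ! k"
      then have "q = p"
        using same[OF p q(1)] that nth_mem[of k q] nth_mem[of "Suc k" q] by force
      then show "\<exists>l. Suc l < length p \<and> p ! l = q ! k \<and> p ! Suc l = q ! Suc k"
        using q by blast
    qed (use p in blast)
    consider "a \<notin> set p" | "a = hd p" | k where "Suc k < length p" "a = p ! Suc k"
    proof -
      assume *: "a \<notin> set p \<Longrightarrow> thesis" "a = hd p \<Longrightarrow> thesis"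
        "\<And>k. Suc k < length p \<Longrightarrow> a = p ! Suc k \<Longrightarrow> thesis"
      show thesis
      proof (cases "a \<in> set p")
        case True
        then obtain l where l: "l < length p" "a = p ! l"
          by (auto simp: in_set_conv_nth)
        then show thesis
          using *(2,3) ne by (cases l) (auto simp: hd_conv_nth)
      qed (use *(1) in blast)
    qed
    then show "?w $ a = axis (hd p) 1 $ a + (\<Sum>b\<in>UNIV. J $ a $ b * ?w $ b)"
    proof cases
      case 1
      have "J $ a $ b * ?w $ b = 0" for b
        using 1 step[of b] nth_mem by (force simp: J_def)
      then have "(\<Sum>b\<in>UNIV. J $ a $ b * ?w $ b) = 0"
        by (simp only: sum.neutral_const)
      moreover have "a \<noteq> hd p" using 1 ne by auto
      ultimately show ?thesis using 1 by (simp add: axis_def)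
    next
      case 2
      have "\<not> step a b" for b
        using 2 ne dist step[of b] by (auto simp: hd_conv_nth nth_eq_iff_index_eq)
      then show ?thesis using 2 ne by (simp add: axis_def J_def)
    next
      case 3
      have "J $ a $ b * ?w $ b = (if b = p ! k then 1 else 0)" for b
        using 3 dist step[of b] by (auto simp: J_def nth_eq_iff_index_eq)
      moreover have "a \<noteq> hd p"
        using 3 dist ne by (auto simp: hd_conv_nth nth_eq_iff_index_eq)
      ultimately have "axis (hd p) 1 $ a + (\<Sum>b\<in>UNIV. J $ a $ b * ?w $ b) = 1"
        by (simp only:) (simp add: axis_def)
      then show ?thesis using 3 by simp
    qed
  qed
  define M :: "real^'v^'v" where
    "M = (\<chi> i j. if i \<in> N \<and> j \<in> Ne then transfer_matrix J $ i $ j else 0)"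
  have "axis j 1 \<in> range (\<lambda>x. M *v x)" if j: "j \<in> N" for j
  proof -
    \<comment> \<open>The path to \<open>j\<close> meets \<open>N\<close> only in \<open>j\<close>:
      another \<open>i\<close> in \<open>N\<close> on it would also lie on \<open>r i\<close>, so
      the two paths and hence their ends would agree. The column of its first node therefore
      restricts to a unit vector on \<open>N\<close>.\<close>
    have "i \<in> set (r j) \<longleftrightarrow> i = j" if "i \<in> N" for i
      using same[OF r(1)[OF j] r(1)[OF that], of i] r(2)[OF j] r(2)[OF that] path[OF r(1)[OF j]]
        path[OF r(1)[OF that]] last_in_set unfolding is_path_def by metis
    moreover have "(M *v axis (hd (r j)) 1) $ i =
        (if i \<in> N then (transfer_matrix J *v axis (hd (r j)) 1) $ i else 0)" for i
      using hd[OF r(1)[OF j]] by (simp add: matrix_vector_mult_basis column_def M_def)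
    ultimately have "(M *v axis (hd (r j)) 1) $ i = axis j 1 $ i" for i
      using j unfolding T[OF r(1)[OF j]] by (simp add: axis_def[of j])
    then have "M *v axis (hd (r j)) 1 = axis j 1"
      by (simp only: vec_eq_iff simp_thms)
    then show ?thesis by (metis rangeI)
  qed
  then have sub: "(\<lambda>j. axis j 1) ` N \<subseteq> range (\<lambda>x. M *v x)"
    by blast
  have "card N = card ((\<lambda>j. axis j 1 :: real^'v) ` N)"
    by (intro card_image[symmetric] inj_onI) (simp add: axis_eq_axis)
  also have "\<dots> \<le> dim (range (\<lambda>x. M *v x))"
    using sub
    by (rule independent_card_le_dim)
       (rule independent_mono[OF independent_Basis], auto simp: Basis_vec_def)
  also have "\<dots> = sub_rank N Ne (transfer_matrix J)"
    by (simp add: sub_rank_def M_def rank_dim_range)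
  also have "\<dots> \<le> max_sub_rank E N Ne"
    unfolding max_sub_rank_def
    by (rule Max_ge[OF max_sub_rank_finite_nonempty(1)]) (use J in blast)
  finally show ?thesis .
qed

end

section \<open>From rank to open sets of outputs\<close>

text \<open>The range of the zero-padded matrix lies in the space of vectors supported on
  \<open>A\<close>, whose dimension is \<open>card A\<close>; the rank bound makes the two spaces
  equal.\<close>

lemma card_le_sub_rank_imp_surj:
  fixes M :: "real^'w^'v" and z :: "real^'v"
  assumes "card A \<le> sub_rank A B M"
  shows "\<exists>h. \<forall>i\<in>A. (M *v (\<chi> k. if k \<in> B then h $ k else 0)) $ i = z $ i"
proof -
  define L :: "real^'w^'v" where "L = (\<chi> i j. if i \<in> A \<and> j \<in> B then M $ i $ j else 0)"
  let ?S = "{x :: real^'v. \<forall>i. i \<notin> A \<longrightarrow> x $ i = 0}"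
  have L: "(L *v h) $ i = (if i \<in> A then (M *v (\<chi> k. if k \<in> B then h $ k else 0)) $ i else 0)" for h i
    by (auto simp: L_def matrix_vector_mult_def intro!: sum.cong)
  have "range (\<lambda>x. L *v x) = ?S"
  proof (rule subspace_dim_equal)
    show "subspace (range (\<lambda>x. L *v x))"
      by (metis linear_subspace_image matrix_vector_mul_linear subspace_UNIV)
    show "subspace ?S"
      by (auto simp: subspace_def)
    show "range (\<lambda>x. L *v x) \<subseteq> ?S"
      by (auto simp: L)
    have "dim ?S = card A"
      using dim_substandard_cart[of A, where 'a = real] by (simp add: dim_vec_eq)
    then show "dim ?S \<le> dim (range (\<lambda>x. L *v x))"
      using assms by (simp add: sub_rank_def L_def rank_dim_range)
  qed
  then have "(\<chi> i. if i \<in> A then z $ i else 0) \<in> range (\<lambda>x. L *v x)"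
    by simp
  then obtain h where h: "(\<chi> i. if i \<in> A then z $ i else 0) = L *v h"
    by blast
  have "(L *v h) $ i = (if i \<in> A then z $ i else 0)" for i
    unfolding h[symmetric] by simp
  then show ?thesis
    unfolding L by metis
qed

text \<open>
  The coordinates outside \<open>N\<close> are filled up with free variables, which turns the outputs on \<open>N\<close>
  into a submersion onto the whole space.
\<close>

lemma interior_of_static_outputs:
  fixes E :: "('v::finite \<times> 'v) set"
  assumes dag: "acyclic E"
    and f: "\<And>i j x. (i, j) \<in> E \<Longrightarrow> (f i j has_field_derivative deriv (f i j) x) (at x)"
    and rank: "card N \<le> sub_rank N Ne (transfer_matrix (network_matrix E f Ne v))"
  shows "interior {x :: real^'v. \<exists>w. \<forall>j\<in>N. x $ j = static_output E f Ne w j} \<noteq> {}"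
proof -
  define T where "T = transfer_matrix (network_matrix E f Ne v)"
  define \<Phi> :: "(real^'v) \<times> (real^'v) \<Rightarrow> real^'v" where
    "\<Phi> = (\<lambda>p. \<chi> j. if j \<in> N then static_output E f Ne (($) (fst p)) j else snd p $ j)"
  define L :: "(real^'v) \<times> (real^'v) \<Rightarrow> real^'v" where
    "L = (\<lambda>p. \<chi> j. if j \<in> N then (T *v (\<chi> k. if k \<in> Ne then fst p $ k else 0)) $ j else snd p $ j)"
  define x where "x = ((\<chi> j. v j) :: real^'v, 0 :: real^'v)"
  have v: "($) (fst x) = v"
    by (auto simp: x_def)
  have deriv: "(\<Phi> has_derivative L) (at x)"
  proof (subst has_derivative_componentwise_within, rule ballI)
    fix b :: "real^'v" assume "b \<in> Basis"
    then obtain j where b: "b = axis j 1" by (auto simp: Basis_vec_def)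
    have "((\<lambda>p. static_output E f Ne (($) (fst p)) j) has_derivative
        (\<lambda>p. (T *v (\<chi> k. if k \<in> Ne then fst p $ k else 0)) $ j)) (at x)"
      using has_derivative_compose[OF has_derivative_fst[OF has_derivative_ident]
          static_output_has_derivative[where f = f and Ne = Ne and i = j, OF dag f]]
      unfolding T_def v[symmetric] by blast
    moreover have "((\<lambda>p. snd p $ j) has_derivative (\<lambda>p. snd p $ j)) (at x)"
      by (intro bounded_linear_imp_has_derivative bounded_linear_compose[OF bounded_linear_vec_nth bounded_linear_snd])
    ultimately show "((\<lambda>p. \<Phi> p \<bullet> b) has_derivative (\<lambda>p. L p \<bullet> b)) (at x)"
      by (cases "j \<in> N") (simp_all add: b \<Phi>_def L_def inner_axis)
  qed
  have "\<exists>p. L p = z" for z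
  proof -
    obtain h where "\<forall>i\<in>N. (T *v (\<chi> k. if k \<in> Ne then h $ k else 0)) $ i = z $ i"
      using card_le_sub_rank_imp_surj[OF rank, of z] by (auto simp: T_def)
    then have "L (h, z) = z"
      by (simp add: L_def vec_eq_iff cong: if_cong)
    then show ?thesis ..
  qed
  then have "surj L"
    by (metis surjI surj_def)
  moreover have "linear L"
    using deriv by (simp add: has_derivative_linear)
  ultimately obtain R where R: "linear R" "L \<circ> R = id"
    using linear_surjective_right_inverse by blast
  have "continuous_on UNIV \<Phi>"
  proof (unfold \<Phi>_def, intro continuous_on_vec_lambda)
    fix j
    have "continuous_on UNIV (\<lambda>p :: (real^'v) \<times> (real^'v). static_output E f Ne (($) (fst p)) j)"
    proof (rule continuous_on_static_output[OF dag])
      show "\<forall>(i, j)\<in>E. continuous_on UNIV (f i j)"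
      proof safe
        fix i j assume "(i, j) \<in> E"
        then show "continuous_on UNIV (f i j)"
          by (intro DERIV_continuous_on[where D = "deriv (f i j)"] f)
      qed
    qed (intro continuous_intros)
    then show "continuous_on UNIV (\<lambda>p :: (real^'v) \<times> (real^'v).
        if j \<in> N then static_output E f Ne (($) (fst p)) j else snd p $ j)"
      by (cases "j \<in> N") (auto intro!: continuous_intros)
  qed
  \<comment> \<open>The rank is known at one point only, but continuity of \<open>\<Phi>\<close> and
    a right inverse of its derivative there already make the image a neighbourhood of
    \<open>\<Phi> x\<close>.\<close>
  then have "\<Phi> x \<in> interior (\<Phi> ` UNIV)"
    by (rule sussmann_open_mapping[OF open_UNIV _ UNIV_I deriv])
       (use R in \<open>auto simp: linear_conv_bounded_linear\<close>)
  moreover have "range \<Phi> \<subseteq> {x. \<exists>w. \<forall>j\<in>N. x $ j = static_output E f Ne w j}"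
    by (auto simp: \<Phi>_def)
  ultimately show ?thesis
    using interior_mono by blast
qed

section \<open>Separating summands and recognizing shifts\<close>

text \<open>Moving only coordinate \<open>j\<close> of an interior point leaves all other summands
  fixed, so \<open>f j - g j\<close> is locally constant. Analyticity extends this to the line, and
  the value at 0 fixes the constant.\<close>

lemma F_ZNL_eq_of_sum_eq_on_interior:
  fixes S :: "(real^'v::finite) set"
  assumes F: "\<And>j. j \<in> N \<Longrightarrow> f j \<in> F_ZNL" "\<And>j. j \<in> N \<Longrightarrow> g j \<in> F_ZNL"
    and eq: "\<And>x. x \<in> S \<Longrightarrow> (\<Sum>j\<in>N. f j (x $ j)) = (\<Sum>j\<in>N. g j (x $ j))"
    and "interior S \<noteq> {}" and j: "j \<in> N"
  shows "f j = g j"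
proof -
  define h where "h = (\<lambda>k x. f k x - g k x)"
  obtain p where p: "p \<in> interior S" using assms by blast
  let ?q = "\<lambda>t. (\<chi> k. if k = j then t else p $ k)"
  have "?q (p $ j) = p"
    by (simp add: vec_eq_iff)
  moreover have "continuous_on UNIV (\<lambda>t. ?q t)"
  proof (intro continuous_on_vec_lambda)
    fix k show "continuous_on UNIV (\<lambda>t. if k = j then t else p $ k)"
      by (cases "k = j") simp_all
  qed
  then have "open ((\<lambda>t. ?q t) -` interior S)"
    by (simp add: open_vimage)
  ultimately have "\<forall>\<^sub>F t in nhds (p $ j). ?q t \<in> interior S"
    using p by (auto simp: eventually_nhds)
  then have "\<forall>\<^sub>F t in nhds (p $ j). h j t - h j (p $ j) = 0"
  proof (rule eventually_mono)
    fix t assume "?q t \<in> interior S"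
    then have "?q t \<in> S" "p \<in> S"
      using p interior_subset by blast+
    then have "(\<Sum>k\<in>N. h k (?q t $ k)) = 0" "(\<Sum>k\<in>N. h k (p $ k)) = 0"
      using eq by (auto simp: h_def sum_subtractf simp del: vec_lambda_beta)
    moreover have "(\<Sum>k\<in>N. h k (?q t $ k)) = h j t + (\<Sum>k\<in>N - {j}. h k (p $ k))"
      by (subst sum.remove[OF _ j]) (auto intro!: sum.cong)
    moreover have "(\<Sum>k\<in>N. h k (p $ k)) = h j (p $ j) + (\<Sum>k\<in>N - {j}. h k (p $ k))"
      by (rule sum.remove[OF _ j]) simp
    ultimately show "h j t - h j (p $ j) = 0" by simp
  qed
  moreover have "real_analytic (\<lambda>t. h j t - h j (p $ j))"
    unfolding h_def using F[OF j]
    by (intro real_analytic_diff real_analytic_const F_ZNL_real_analytic)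
  ultimately have h: "h j t - h j (p $ j) = 0" for t
    using real_analytic_identity by blast
  have "h j 0 = 0"
    using F[OF j] by (simp add: h_def F_ZNL_0)
  then have "h j t = 0" for t
    using h[of 0] h[of t] by simp
  then show ?thesis
    by (auto simp: h_def)
qed

text \<open>
  A nonlinear analytic function has no interval of arguments \<open>d\<close> for which \<open>f (x + d) - f x\<close> is
  independent of \<open>x\<close>; the differences \<open>s - t\<close> form such an interval by connectedness.
\<close>

lemma F_ZNL_shift_unique:
  fixes s t r q :: "real \<Rightarrow> real"
  assumes f: "f \<in> F_ZNL" and g: "g \<in> F_ZNL"
    and cont: "continuous_on {0..1} s" "continuous_on {0..1} t"
    and zero: "s 0 = 0" "t 0 = 0" "r 0 = 0" "q 0 = 0"
    and eq: "\<And>c x. c \<in> {0..1} \<Longrightarrow> f (x + s c) + r c = g (x + t c) + q c"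
  shows "s 1 = t 1"
proof -
  \<comment> \<open>At \<open>c = 0\<close> all shifts and offsets vanish.\<close>
  have fg: "f = g"
    using eq[of 0] zero by auto
  define d where "d = s 1 - t 1"
  have "connected ((\<lambda>c. s c - t c) ` {0..1})"
    by (intro connected_continuous_image continuous_intros cont) auto
  then have conv: "convex ((\<lambda>c. s c - t c) ` {0..1})"
    using is_interval_connected_1 is_interval_convex_1 by blast
  have "(\<lambda>c. s c - t c) 0 \<in> (\<lambda>c. s c - t c) ` {0..1}" "(\<lambda>c. s c - t c) 1 \<in> (\<lambda>c. s c - t c) ` {0..1}"
    by (rule imageI, simp)+
  \<comment> \<open>The image contains 0 (at \<open>c = 0\<close>) and \<open>d\<close> (at
    \<open>c = 1\<close>), hence the whole segment between them.\<close>
  then have mem: "a * d \<in> (\<lambda>c. s c - t c) ` {0..1}" if "a \<in> {0..1}" for a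
    using convexD[OF conv, of 0 d "1 - a" a] that zero by (simp add: d_def)
  have "f (x + a * d) = f x + f (a * d)" if a: "a \<in> {0..1}" for a x
  proof -
    obtain c where c: "c \<in> {0..1}" "a * d = s c - t c"
      using mem[OF a] by blast
    have "f (x + a * d) - f x = q c - r c" for x
    proof -
      have shift: "x - t c + s c = x + a * d" using c(2) by simp
      have "f (x + a * d) + r c = f x + q c"
        using eq[OF c(1), of "x - t c"] unfolding shift fg by simp
      then show ?thesis by simp
    qed
    \<comment> \<open>The right-hand side is free of \<open>x\<close>, so the increments at
      \<open>x\<close> and at 0 agree, and \<open>f 0 = 0\<close>.\<close>
    from this[of x] this[of 0] show ?thesis
      using F_ZNL_0[OF f] by simp
  qed
  then have "d = 0"
    by (rule F_ZNL_not_additive_on_interval[OF f])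
  then show ?thesis by (simp add: d_def)
qed

section \<open>Passing from out-neighbors to an excited node\<close>

text \<open>All excitations except that of \<open>j\<close> are scaled by \<open>c\<close>, which
  joins the zero point to \<open>v\<close>, while that of \<open>j\<close> is a free variable
  \<open>x\<close>. The output of a suitable out-neighbor \<open>i\<close> then has the form
  \<open>h i j (x + s h c) + r h c\<close>, to which uniqueness of the shift applies.\<close>

lemma static_output_eq_backwards:
  fixes E :: "('v::finite \<times> 'v) set"
  assumes dag: "acyclic E"
    and f: "\<forall>(i, j)\<in>E. f i j \<in> F_ZNL" and g: "\<forall>(i, j)\<in>E. g i j \<in> F_ZNL"
    and j: "j \<in> Ne" "out_nbrs E j \<noteq> {}"
    and eq: "\<And>i v. (i, j) \<in> E \<Longrightarrow> static_output E f Ne v i = static_output E g Ne v i"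
  shows "static_output E f Ne v j = static_output E g Ne v j"
proof -
  have "wf ((E\<inverse>)\<^sup>+)"
    using wf_edges(2)[OF dag] by (rule wf_trancl)
  \<comment> \<open>The relation in \<open>min\<close> says that \<open>k\<close> has a path of
    positive length to \<open>i\<close>.\<close>
  then obtain i where i: "i \<in> out_nbrs E j"
    and min: "\<And>k. (k, i) \<in> (E\<inverse>)\<^sup>+ \<Longrightarrow> k \<notin> out_nbrs E j"
    using j(2) by (meson ex_in_conv wfE_min)
  have ij: "(i, j) \<in> E" using i by (simp add: out_nbrs_def)
  \<comment> \<open>A path from \<open>j\<close> to another in-neighbor of \<open>i\<close> would
    leave \<open>j\<close> through an out-neighbor \<open>k\<close> that has a path to
    \<open>i\<close>, against minimality.\<close>
  have fresh: "(l, j) \<notin> E\<^sup>*" if l: "l \<in> in_nbrs E i - {j}" for l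
  proof
    assume "(l, j) \<in> E\<^sup>*"
    then obtain k where k: "(l, k) \<in> E\<^sup>*" "(k, j) \<in> E"
      using l by (auto elim: rtranclE)
    then have "(i, k) \<in> E\<^sup>+"
      using l by (auto simp: in_nbrs_def)
    then have "(k, i) \<in> (E\<inverse>)\<^sup>+"
      by (simp add: trancl_converse)
    then show False using min[of k] k by (simp add: out_nbrs_def)
  qed
  have fresh': "(l, j) \<notin> E\<^sup>*" if "l \<in> in_nbrs E j" for l
    using that dag by (auto simp: in_nbrs_def acyclic_def dest: rtrancl_into_trancl2)
  \<comment> \<open>\<open>s\<close> is the input to \<open>j\<close> from its in-neighbors and
    \<open>r\<close> is everything in the output of \<open>i\<close> that avoids \<open>j\<close>.
    Both take the family \<open>h\<close> as an argument, so that one computation serves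
    \<open>f\<close> and \<open>g\<close>.\<close>
  define s where "s = (\<lambda>h c. \<Sum>l\<in>in_nbrs E j. h j l (static_output E h Ne (\<lambda>k. c * v k) l))"
  define r where "r = (\<lambda>h c. (if i \<in> Ne then c * v i else 0) +
    (\<Sum>l\<in>in_nbrs E i - {j}. h i l (static_output E h Ne (\<lambda>k. c * v k) l)))"
  have zero: "s h 0 = 0 \<and> r h 0 = 0" if "\<forall>(i, j)\<in>E. h i j \<in> F_ZNL" for h
  proof -
    have h0: "\<forall>(i, j)\<in>E. h i j 0 = 0"
      using that by (auto simp: F_ZNL_0)
    then have "\<And>l. static_output E h Ne (\<lambda>k. 0) l = 0"
      by (rule static_output_0[OF dag])
    then show ?thesis
      using h0 by (auto simp: s_def r_def in_nbrs_def intro!: sum.neutral)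
  qed
  have cont: "continuous_on {0..1} (s h)" if h: "\<forall>(i, j)\<in>E. h i j \<in> F_ZNL" for h
    unfolding s_def
  proof (intro continuous_on_sum)
    fix l assume "l \<in> in_nbrs E j"
    then have "continuous_on UNIV (h j l)"
      using h by (auto simp: in_nbrs_def intro: F_ZNL_continuous)
    moreover have "continuous_on {0..1} (\<lambda>c. static_output E h Ne (\<lambda>k. c * v k) l)"
      by (rule continuous_on_static_output[OF dag])
        (use h in \<open>auto intro: F_ZNL_continuous continuous_intros\<close>)
    ultimately show "continuous_on {0..1} (\<lambda>c. h j l (static_output E h Ne (\<lambda>k. c * v k) l))"
      by (rule continuous_on_compose2) simp
  qed
  have val: "static_output E h Ne ((\<lambda>k. c * v k)(j := x)) i = h i j (x + s h c) + r h c" for h c x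
  proof -
    let ?w = "(\<lambda>k. c * v k)(j := x)"
    have same: "static_output E h Ne ?w l = static_output E h Ne (\<lambda>k. c * v k) l"
      if "(l, j) \<notin> E\<^sup>*" for l
      by (rule static_output_cong[OF dag]) (use that in auto)
    have "static_output E h Ne ?w j = x + s h c"
      using j(1) same[OF fresh'] by (simp add: static_output_rec[OF dag, of h Ne ?w j] s_def)
    moreover have "i \<noteq> j"
      using ij dag by (auto simp: acyclic_def)
    moreover have "(\<Sum>l\<in>in_nbrs E i. h i l (static_output E h Ne ?w l)) =
        h i j (static_output E h Ne ?w j) +
        (\<Sum>l\<in>in_nbrs E i - {j}. h i l (static_output E h Ne (\<lambda>k. c * v k) l))"
      using ij same[OF fresh] by (subst sum.remove[of _ j]) (auto simp: in_nbrs_def)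
    ultimately show ?thesis
      by (simp add: static_output_rec[OF dag, of h Ne ?w i] r_def)
  qed
  have "s f 1 = s g 1"
  proof (rule F_ZNL_shift_unique[of "f i j" "g i j" "s f" "s g" "r f" "r g"])
    show "f i j (x + s f c) + r f c = g i j (x + s g c) + r g c" for c x
      using eq[OF ij, of "(\<lambda>k. c * v k)(j := x)"] by (simp only: val)
  qed (use f g ij zero cont in auto)
  then show ?thesis
    by (simp add: s_def static_output_rec[OF dag, of _ Ne v j])
qed

section \<open>Identifiability\<close>

theorem theorem1:
  fixes E :: "('v::finite \<times> 'v) set"
    and m :: "'v \<Rightarrow> 'v \<Rightarrow> nat"
    and Ne Nm :: "'v set"
    and f :: "'v \<Rightarrow> 'v \<Rightarrow> real \<Rightarrow> real"
  assumes dag: "acyclic E"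
    and connected: "weakly_connected E"
    and delays: "\<forall>(i, j)\<in>E. m i j \<ge> 1"
    and single: "single_delay E m Ne"
    and actions: "card Ne + card Nm = CARD('v)"
    and f_class: "\<forall>(i, j)\<in>E. f i j \<in> F_ZNL"
    and generic: "generic_network E f Ne"
    and sources: "\<forall>i. is_source E i \<longrightarrow> i \<in> Ne"
    and sinks: "\<forall>i. is_sink E i \<longrightarrow> i \<in> Nm"
    and others: "\<forall>i. \<not> is_source E i \<and> \<not> is_sink E i \<longrightarrow> i \<in> Ne \<or> i \<in> Nm"
    and disjoint: "\<forall>i. disjoint_paths_to E Ne (in_nbrs E i)"
  shows "\<forall>g :: 'v \<Rightarrow> 'v \<Rightarrow> real \<Rightarrow> real.
           (\<forall>(i, j)\<in>E. g i j \<in> F_ZNL) \<longrightarrow>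
           (\<forall>i\<in>Nm. \<forall>u k. unrolled E m f Ne u i k = unrolled E m g Ne u i k) \<longrightarrow>
           (\<forall>(i, j)\<in>E. f i j = g i j)"
proof (intro allI impI)
  fix g :: "'v \<Rightarrow> 'v \<Rightarrow> real \<Rightarrow> real"
  assume g: "\<forall>(i, j)\<in>E. g i j \<in> F_ZNL"
    and meas: "\<forall>i\<in>Nm. \<forall>u k. unrolled E m f Ne u i k = unrolled E m g Ne u i k"
  have out: "static_output E f Ne v i = static_output E g Ne v i" for v i
    \<comment> \<open>Induction along \<open>E\<close> treats the out-neighbors of a node before the
      node itself. The point \<open>v\<close> must vary, since agreement at an out-neighbor is used
      for altered excitations.\<close>
    using wf_edges(1)[OF dag]
  proof (induction i arbitrary: v rule: wf_induct_rule)
    case (less i)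
    show ?case
    proof (cases "i \<in> Nm")
      case True
      then show ?thesis
        using meas by (simp flip: unrolled_const[OF dag, where m = m and k = 0])
    next
      case False
      then have "i \<in> Ne" "out_nbrs E i \<noteq> {}"
        using sources sinks others unfolding is_sink_def by blast+
      then show ?thesis
        using static_output_eq_backwards[OF dag f_class g] less by blast
    qed
  qed
  obtain v where v: "\<And>A B. sub_rank A B (transfer_matrix (network_matrix E f Ne v)) = max_sub_rank E A B"
    using generic unfolding generic_network_def by blast
  show "\<forall>(i, j)\<in>E. f i j = g i j"
  proof safe
    fix i j assume ij: "(i, j) \<in> E"
    let ?N = "in_nbrs E i"
    have deriv: "(f i j has_field_derivative deriv (f i j) x) (at x)" if "(i, j) \<in> E" for i j x
      using that f_class F_ZNL_real_analytic real_analytic_imp_DERIV by blast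
    \<comment> \<open>Genericity makes the rank at \<open>v\<close> maximal, and the disjoint paths
      bound the maximum from below.\<close>
    have rank: "card ?N \<le> sub_rank ?N Ne (transfer_matrix (network_matrix E f Ne v))"
      using card_le_max_sub_rank[OF dag] disjoint v by simp
    \<comment> \<open>The own excitation of \<open>i\<close> cancels; since all outputs agree, those
      of \<open>g\<close> can be replaced by those of \<open>f\<close>, and both sums are evaluated
      at the same point.\<close>
    have sums: "(\<Sum>j\<in>?N. f i j (static_output E f Ne w j)) =
        (\<Sum>j\<in>?N. g i j (static_output E f Ne w j))" for w
      using out[of w i] by (simp add: static_output_rec[OF dag, of _ Ne w i] out)
    show "f i j = g i j"
    proof (rule F_ZNL_eq_of_sum_eq_on_interior[OF _ _ _ interior_of_static_outputs[OF dag deriv rank]])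
      fix x :: "real^'v"
      assume "x \<in> {x. \<exists>w. \<forall>j\<in>?N. x $ j = static_output E f Ne w j}"
      then obtain w where "\<forall>j\<in>?N. x $ j = static_output E f Ne w j" by blast
      then show "(\<Sum>j\<in>?N. f i j (x $ j)) = (\<Sum>j\<in>?N. g i j (x $ j))"
        using sums[of w] by (simp cong: sum.cong)
    qed (use f_class g ij in \<open>auto simp: in_nbrs_def\<close>)
  qed
qed

end
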